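(* Let $L$ be a $\sigma$-frame. If $f,g\in\mathsf{SM}(L)$ are simple functions and $\lambda\in\mathbb{Q}$, then $\lambda\cdot f$, $-f$, $f\cdot g$, $f+g$ and $|f|$ are simple functions. Consequently, $\mathsf{SM}(L)$ is a subring of $\mathsf{M}(L)$.
   Context: A $\sigma$-frame is a bounded lattice with all countable joins in which $(\bigvee_{a\in A}a)\wedge b=\bigvee_{a\in A}(a\wedge b)$ for every countable $A$ and every $b$. A $\sigma$-frame homomorphism preserves finite meets (including the top) and countable joins (including the bottom). $\mathfrak{L}(\mathbb{R})$ is the frame, equivalently $\sigma$-frame, generated by symbols $(p,\text{---})$, $(\text{---},q)$ ($p,q\in\mathbb{Q}$) subject to: $(p,\text{---})\wedge(\text{---},q)=0$ if $p\ge q$; $(p,\text{---})\vee(\text{---},q)=1$ if $p<q$; $(p,\text{---})=\bigvee_{r>p}(r,\text{---})$; $(\text{---},q)=\bigvee_{s<q}(\text{---},s)$; $\bigvee_p(p,\text{---})=1=\bigvee_q(\text{---},q)$. $\mathsf{M}(L)$ is the set of $\sigma$-frame homomorphisms $\mathfrak{L}(\mathbb{R})\to L$, ordered by $f\le g$ iff $f(p,\text{---})\le g(p,\text{---})$ for all $p$. $\mathsf{M}(L)$ is a commutative ring and a $\mathbb{Q}$-algebra (known) under the following operations. Constants, for $r\in\mathbb{Q}$: $\mathbf{r}(p,\text{---})=1$ if $p<r$, else $0$; $\mathbf{r}(\text{---},q)=1$ if $q>r$, else $0$; the zero is $\mathbf{0}$ and the unit is $\mathbf{1}$. Scalars: $(\lambda\cdot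 f)(p,\text{---})=f(p/\lambda,\text{---})$, $(\lambda\cdot f)(\text{---},q)=f(\text{---},q/\lambda)$ for rational $\lambda>0$; $(-f)(p,\text{---})=f(\text{---},-p)$, $(-f)(\text{---},q)=f(-q,\text{---})$; $0\cdot f=\mathbf{0}$ and $\lambda\cdot f=-((-\lambda)\cdot f)$ for $\lambda<0$. Sum: $(f+g)(p,\text{---})=\bigvee_{t\in\mathbb{Q}}(f(t,\text{---})\wedge g(p-t,\text{---}))$, $(f+g)(\text{---},q)=\bigvee_{t\in\mathbb{Q}}(f(\text{---},t)\wedge g(\text{---},q-t))$. Join: $(f\vee g)(p,\text{---})=f(p,\text{---})\vee g(p,\text{---})$, $(f\vee g)(\text{---},q)=f(\text{---},q)\wedge g(\text{---},q)$. Put $f^+=f\vee\mathbf{0}$, $f^-=(-f)\vee\mathbf{0}$, $|f|=f^++f^-$; then $f=f^+-f^-$. Product for $f,g\ge\mathbf{0}$: $(f\cdot g)(p,\text{---})=1$ if $p<0$ and $\bigvee_{s>0}f(s,\text{---})\wedge g(p/s,\text{---})$ if $p\ge0$; $(f\cdot g)(\text{---},q)=0$ if $q\le0$ and $\bigvee_{s>0}f(\text{---},s)\wedge g(\text{---},q/s)$ if $q>0$ ($s\in\mathbb{Q}$). In general $f\cdot g=f^+\cdot g^+ + f^-\cdot g^- - f^+\cdot g^- - f^-\cdot g^+$. For complemented $a\in L$ with complement $a^c$, $\chi_a\in\mathsf{M}(L)$ is given by $\chi_a(p,\text{---})=1$ if $p<0$, $a$ if $0\le p<1$, $0$ if $p\ge1$;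 $\chi_a(\text{---},q)=0$ if $q\le0$, $a^c$ if $0<q\le1$, $1$ if $q>1$. An $f\in\mathsf{M}(L)$ is simple if $f=\sum_{i=1}^n r_i\cdot\chi_{a_i}$ for some $n\in\mathbb{N}$, $r_1,\ldots,r_n\in\mathbb{Q}$ and complemented $a_1,\ldots,a_n\in L$. $\mathsf{SM}(L)=\{f\in\mathsf{M}(L)\mid f\text{ is simple}\}$. *)

theory Defs
  imports "HOL-Library.Countable_Set_Type" "HOL-Algebra.Subrings"
begin

hide_const (open) Order.top Order.bottom

section \<open>Sigma-frames and their homomorphisms\<close>

text \<open>\<open>Sup\<close> is a total operation, but it is constrained on countable sets only. The trivial
  \<open>\<sigma>\<close>-frame (\<open>bot = top\<close>) is allowed.\<close>

class sigma_frame = bounded_lattice + Sup +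
  assumes csup_upper: "countable A \<Longrightarrow> x \<in> A \<Longrightarrow> x \<le> Sup A"
    and csup_least: "countable A \<Longrightarrow> (\<And>x. x \<in> A \<Longrightarrow> x \<le> z) \<Longrightarrow> Sup A \<le> z"
    and csup_inf: "countable A \<Longrightarrow> inf (Sup A) b = (SUP a\<in>A. inf a b)"

text \<open>The case \<open>A = {}\<close> gives preservation of the bottom element.\<close>

definition sigma_frame_hom :: "('a::sigma_frame \<Rightarrow> 'b::sigma_frame) \<Rightarrow> bool" where
  "sigma_frame_hom h \<longleftrightarrow>
     h top = top \<and> (\<forall>x y. h (inf x y) = inf (h x) (h y)) \<and>
     (\<forall>A. countable A \<longrightarrow> h (Sup A) = (SUP a\<in>A. h a))"

definition is_compl :: "'a::bounded_lattice \<Rightarrow> 'a \<Rightarrow> bool" where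
  "is_compl a c \<longleftrightarrow> inf a c = bot \<and> sup a c = top"

definition complemented :: "'a::bounded_lattice \<Rightarrow> bool" where
  "complemented a \<longleftrightarrow> (\<exists>c. is_compl a c)"

text \<open>Complements are unique because \<open>\<sigma>\<close>-frames are distributive.\<close>

definition cmpl :: "'a::sigma_frame \<Rightarrow> 'a" where
  "cmpl a = (THE c. is_compl a c)"


section \<open>The frame of reals\<close>

text \<open>The frame of reals is presented by generators and relations: \<open>rle\<close> is the least preorder on
  terms in the generators that makes the quotient a \<open>\<sigma>\<close>-frame in which the relations hold.\<close>

datatype rterm =
  Lo rat  \<comment> \<open>the generator written \<open>(p,---)\<close>\<close>
| Up rat  \<comment> \<open>the generator written \<open>(---,q)\<close>\<close>
| Top
| Meet rterm rterm
| Join "rterm cset"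

inductive rle :: "rterm \<Rightarrow> rterm \<Rightarrow> bool" where
  refl: "rle s s"
| trans: "rle s t \<Longrightarrow> rle t u \<Longrightarrow> rle s u"
| top: "rle s Top"
| meet1: "rle (Meet s t) s"
| meet2: "rle (Meet s t) t"
| meet: "rle u s \<Longrightarrow> rle u t \<Longrightarrow> rle u (Meet s t)"
| upper: "s \<in> rcset A \<Longrightarrow> rle s (Join A)"
| least: "(\<And>s. s \<in> rcset A \<Longrightarrow> rle s t) \<Longrightarrow> rle (Join A) t"
| distr: "rle (Meet (Join A) t) (Join (cimage (\<lambda>s. Meet s t) A))"
| disjoint: "q \<le> p \<Longrightarrow> rle (Meet (Lo p) (Up q)) (Join cempty)"
| cover: "p < q \<Longrightarrow> rle Top (Join (acset {Lo p, Up q}))"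
| lo_ge: "p < r \<Longrightarrow> rle (Lo r) (Lo p)"
| lo_le: "rle (Lo p) (Join (acset (Lo ` {p<..})))"
| up_ge: "r < q \<Longrightarrow> rle (Up r) (Up q)"
| up_le: "rle (Up q) (Join (acset (Up ` {..<q})))"
| lo_top: "rle Top (Join (acset (range Lo)))"
| up_top: "rle Top (Join (acset (range Up)))"

definition req :: "rterm \<Rightarrow> rterm \<Rightarrow> bool" where
  "req s t \<longleftrightarrow> rle s t \<and> rle t s"

quotient_type lreals = rterm / req
  by (intro equivpI reflpI sympI transpI) (auto simp: req_def intro: rle.refl rle.trans)

lemma Join_mono:
  assumes "\<And>s. s \<in> rcset A \<Longrightarrow> \<exists>t\<in>rcset B. rle s t"
  shows "rle (Join A) (Join B)"
  using assms by (blast intro: rle.least rle.trans rle.upper)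

lemma rcset_cinsert [simp]: "rcset (cinsert x A) = insert x (rcset A)"
  by (simp add: cinsert.rep_eq)

lemma rcset_cempty [simp]: "rcset cempty = {}"
  by (simp add: bot_cset.rep_eq)

instantiation lreals :: "{bounded_lattice, Sup}"
begin

lift_definition less_eq_lreals :: "lreals \<Rightarrow> lreals \<Rightarrow> bool" is rle
  by (auto simp: req_def intro: rle.trans)

definition less_lreals :: "lreals \<Rightarrow> lreals \<Rightarrow> bool" where
  "less_lreals x y \<longleftrightarrow> x \<le> y \<and> \<not> y \<le> x"

lift_definition top_lreals :: lreals is Top .

lift_definition bot_lreals :: lreals is "Join cempty" .

lift_definition inf_lreals :: "lreals \<Rightarrow> lreals \<Rightarrow> lreals" is Meet
  unfolding req_def by (meson rle.meet rle.meet1 rle.meet2 rle.trans)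

lift_definition sup_lreals :: "lreals \<Rightarrow> lreals \<Rightarrow> lreals" is "\<lambda>s t. Join (acset {s, t})"
  by (auto simp: req_def intro!: Join_mono)

definition Sup_lreals :: "lreals set \<Rightarrow> lreals" where
  "Sup_lreals A = abs_lreals (Join (acset (rep_lreals ` A)))"

instance
proof
  fix x y z :: lreals
  show "(x < y) = (x \<le> y \<and> \<not> y \<le> x)" by (simp add: less_lreals_def)
  show "x \<le> x" by transfer (rule rle.refl)
  show "x \<le> y \<Longrightarrow> y \<le> z \<Longrightarrow> x \<le> z" by transfer (rule rle.trans)
  show "x \<le> y \<Longrightarrow> y \<le> x \<Longrightarrow> x = y" by transfer (simp add: req_def)
  show "inf x y \<le> x" by transfer (rule rle.meet1)
  show "inf x y \<le> y" by transfer (rule rle.meet2)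
  show "x \<le> y \<Longrightarrow> x \<le> z \<Longrightarrow> x \<le> inf y z" by transfer (rule rle.meet)
  show "x \<le> sup x y" by transfer (simp add: rle.upper)
  show "y \<le> sup x y" by transfer (simp add: rle.upper)
  show "y \<le> x \<Longrightarrow> z \<le> x \<Longrightarrow> sup y z \<le> x" by transfer (auto intro: rle.least)
  show "bot \<le> x" by transfer (auto intro: rle.least)
  show "x \<le> top" by transfer (rule rle.top)
qed

end

lemma abs_rep [simp]: "abs_lreals (rep_lreals x) = x"
  by (rule Quotient3_abs_rep[OF Quotient3_lreals])

lemma rle_rep_abs: "rle (rep_lreals (abs_lreals s)) s" "rle s (rep_lreals (abs_lreals s))"
  using abs_rep[of "abs_lreals s"] unfolding lreals.abs_eq_iff req_def by blast+

lemma abs_le_iff: "abs_lreals s \<le> abs_lreals t \<longleftrightarrow> rle s t"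
  by (simp add: less_eq_lreals.abs_eq)

lemma le_rep_iff: "x \<le> y \<longleftrightarrow> rle (rep_lreals x) (rep_lreals y)"
  using abs_le_iff[of "rep_lreals x" "rep_lreals y"] by simp

lemma abs_Join: "abs_lreals (Join A) = (SUP s\<in>rcset A. abs_lreals s)"
proof -
  have "req (Join A) (Join (acset ((\<lambda>s. rep_lreals (abs_lreals s)) ` rcset A)))"
    unfolding req_def by (auto intro!: Join_mono rle_rep_abs intro: rle_rep_abs)
  then show ?thesis
    by (simp add: Sup_lreals_def image_image lreals.abs_eq_iff)
qed

instance lreals :: sigma_frame
proof
  fix A :: "lreals set" and x z b :: lreals
  assume A: "countable A"
  then have S: "Sup A = abs_lreals (Join (acset (rep_lreals ` A)))"
    by (simp add: Sup_lreals_def)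
  show "x \<le> Sup A" if "x \<in> A"
    using that A abs_le_iff[of "rep_lreals x" "Join (acset (rep_lreals ` A))"]
    by (auto simp: S intro!: rle.upper)
  show "Sup A \<le> z" if "\<And>x. x \<in> A \<Longrightarrow> x \<le> z"
    using that A abs_le_iff[of "Join (acset (rep_lreals ` A))" "rep_lreals z"]
    by (auto simp: S le_rep_iff intro!: rle.least)
  have *: "inf (abs_lreals s) (abs_lreals t) = abs_lreals (Meet s t)" for s t
    by (simp add: inf_lreals.abs_eq)
  let ?J = "acset (rep_lreals ` A)"
  have "inf (Sup A) b = abs_lreals (Meet (Join ?J) (rep_lreals b))"
    using *[of "Join ?J" "rep_lreals b"] by (simp add: S)
  also have "\<dots> = abs_lreals (Join (cimage (\<lambda>s. Meet s (rep_lreals b)) ?J))"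
  proof -
    have "rle (Join (cimage (\<lambda>s. Meet s (rep_lreals b)) ?J)) (Meet (Join ?J) (rep_lreals b))"
      by (rule rle.least)
        (use A in \<open>auto simp: cimage.rep_eq intro!: rle.meet rle.meet2 intro: rle.trans[OF rle.meet1 rle.upper]\<close>)
    then show ?thesis by (simp add: lreals.abs_eq_iff req_def rle.distr)
  qed
  also have "\<dots> = (SUP a\<in>A. inf a b)"
    using A *[of "rep_lreals _" "rep_lreals b"]
    by (simp add: abs_Join cimage.rep_eq image_image)
  finally show "inf (Sup A) b = (SUP a\<in>A. inf a b)" .
qed

lift_definition lo :: "rat \<Rightarrow> lreals" is Lo .

lift_definition up :: "rat \<Rightarrow> lreals" is Up .


section \<open>The ring of measurable functions\<close>

definition Meas :: "(lreals \<Rightarrow> 'a::sigma_frame) set" where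
  "Meas = {f. sigma_frame_hom f}"

text \<open>Elements of \<open>Meas\<close> are given by their values on generators: \<open>ext u v\<close> is the homomorphism
  with \<open>(p,---) \<mapsto> u p\<close> and \<open>(---,q) \<mapsto> v q\<close>. It exists, and is unique, whenever \<open>u\<close> and \<open>v\<close> respect
  the defining relations (lemma \<open>ext_unique\<close> below).\<close>

definition ext :: "(rat \<Rightarrow> 'a::sigma_frame) \<Rightarrow> (rat \<Rightarrow> 'a) \<Rightarrow> lreals \<Rightarrow> 'a" where
  "ext u v = (THE h. h \<in> Meas \<and> (\<forall>p. h (lo p) = u p) \<and> (\<forall>q. h (up q) = v q))"

definition mconst :: "rat \<Rightarrow> lreals \<Rightarrow> 'a::sigma_frame" where
  "mconst r = ext (\<lambda>p. if p < r then top else bot) (\<lambda>q. if q > r then top else bot)"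

definition mneg :: "(lreals \<Rightarrow> 'a::sigma_frame) \<Rightarrow> lreals \<Rightarrow> 'a" where
  "mneg f = ext (\<lambda>p. f (up (- p))) (\<lambda>q. f (lo (- q)))"

definition pscale :: "rat \<Rightarrow> (lreals \<Rightarrow> 'a::sigma_frame) \<Rightarrow> lreals \<Rightarrow> 'a" where
  "pscale c f = ext (\<lambda>p. f (lo (p / c))) (\<lambda>q. f (up (q / c)))"

definition mscale :: "rat \<Rightarrow> (lreals \<Rightarrow> 'a::sigma_frame) \<Rightarrow> lreals \<Rightarrow> 'a" where
  "mscale c f =
     (if c > 0 then pscale c f else if c = 0 then mconst 0 else mneg (pscale (- c) f))"

definition madd :: "(lreals \<Rightarrow> 'a::sigma_frame) \<Rightarrow> (lreals \<Rightarrow> 'a) \<Rightarrow> lreals \<Rightarrow> 'a" where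
  "madd f g = ext (\<lambda>p. SUP t. inf (f (lo t)) (g (lo (p - t))))
                  (\<lambda>q. SUP t. inf (f (up t)) (g (up (q - t))))"

definition mjoin :: "(lreals \<Rightarrow> 'a::sigma_frame) \<Rightarrow> (lreals \<Rightarrow> 'a) \<Rightarrow> lreals \<Rightarrow> 'a" where
  "mjoin f g = ext (\<lambda>p. sup (f (lo p)) (g (lo p))) (\<lambda>q. inf (f (up q)) (g (up q)))"

text \<open>\<open>pos f\<close> and \<open>npos f\<close> are the positive and negative parts \<open>f\<^sup>+\<close> and \<open>f\<^sup>-\<close>.\<close>

definition pos :: "(lreals \<Rightarrow> 'a::sigma_frame) \<Rightarrow> lreals \<Rightarrow> 'a" where
  "pos f = mjoin f (mconst 0)"

definition npos :: "(lreals \<Rightarrow> 'a::sigma_frame) \<Rightarrow> lreals \<Rightarrow> 'a" where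
  "npos f = mjoin (mneg f) (mconst 0)"

definition modulus :: "(lreals \<Rightarrow> 'a::sigma_frame) \<Rightarrow> lreals \<Rightarrow> 'a" where
  "modulus f = madd (pos f) (npos f)"

text \<open>\<open>ptimes\<close> is the product of nonnegative elements (and is used on them only),
  \<open>mmult\<close> the product in general.\<close>

definition ptimes :: "(lreals \<Rightarrow> 'a::sigma_frame) \<Rightarrow> (lreals \<Rightarrow> 'a) \<Rightarrow> lreals \<Rightarrow> 'a" where
  "ptimes f g =
     ext (\<lambda>p. if p < 0 then top else (SUP s\<in>{0<..}. inf (f (lo s)) (g (lo (p / s)))))
         (\<lambda>q. if q \<le> 0 then bot else (SUP s\<in>{0<..}. inf (f (up s)) (g (up (q / s)))))"

definition mmult :: "(lreals \<Rightarrow> 'a::sigma_frame) \<Rightarrow> (lreals \<Rightarrow> 'a) \<Rightarrow> lreals \<Rightarrow> 'a" where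
  "mmult f g =
     madd (madd (madd (ptimes (pos f) (pos g)) (ptimes (npos f) (npos g)))
                (mneg (ptimes (pos f) (npos g))))
          (mneg (ptimes (npos f) (pos g)))"

definition Meas_ring :: "(lreals \<Rightarrow> 'a::sigma_frame) ring" where
  "Meas_ring = \<lparr>carrier = Meas, mult = mmult, one = mconst 1, zero = mconst 0, add = madd\<rparr>"


section \<open>Simple functions\<close>

definition chi :: "'a::sigma_frame \<Rightarrow> lreals \<Rightarrow> 'a" where
  "chi a = ext (\<lambda>p. if p < 0 then top else if p < 1 then a else bot)
               (\<lambda>q. if q \<le> 0 then bot else if q \<le> 1 then cmpl a else top)"

definition simple :: "(lreals \<Rightarrow> 'a::sigma_frame) \<Rightarrow> bool" where
  "simple f \<longleftrightarrow> (\<exists>(n::nat) (r::nat \<Rightarrow> rat) a. (\<forall>i\<in>{1..n}. complemented (a i)) \<and>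
     f = (\<Oplus>\<^bsub>Meas_ring\<^esub>i\<in>{1..n}. mscale (r i) (chi (a i))))"

definition SM :: "(lreals \<Rightarrow> 'a::sigma_frame) set" where
  "SM = {f \<in> Meas. simple f}"


section \<open>The universal property of the frame of reals\<close>

primrec reval :: "(rat \<Rightarrow> 'a::sigma_frame) \<Rightarrow> (rat \<Rightarrow> 'a) \<Rightarrow> rterm \<Rightarrow> 'a" where
  "reval u v (Lo p) = u p"
| "reval u v (Up q) = v q"
| "reval u v Top = top"
| "reval u v (Meet s t) = inf (reval u v s) (reval u v t)"
| "reval u v (Join A) = Sup (rcset (cimage (reval u v) A))"

definition respects_relations :: "(rat \<Rightarrow> 'a::sigma_frame) \<Rightarrow> (rat \<Rightarrow> 'a) \<Rightarrow> bool" where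
  "respects_relations u v \<longleftrightarrow>
     (\<forall>p q. p \<ge> q \<longrightarrow> inf (u p) (v q) = bot) \<and>
     (\<forall>p q. p < q \<longrightarrow> sup (u p) (v q) = top) \<and>
     (\<forall>p. u p = (SUP r\<in>{p<..}. u r)) \<and> (\<forall>q. v q = (SUP s\<in>{..<q}. v s)) \<and>
     (SUP p. u p) = top \<and> (SUP q. v q) = top"

lemma csup_empty: "Sup {} = (bot::'a::sigma_frame)"
  by (intro antisym csup_least) auto

lemma csup_insert2: "Sup {a, b} = (sup a b::'a::sigma_frame)"
  by (intro antisym csup_least le_supI csup_upper) (auto intro: le_supI1 le_supI2)

lemma reval_mono:
  assumes R: "respects_relations u v" and "rle s t"
  shows "reval u v s \<le> reval u v t"
  using \<open>rle s t\<close>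
proof induction
  case (trans s t w)
  then show ?case by (blast intro: order_trans)
next
  case (upper s A)
  then show ?case by (auto simp: cimage.rep_eq intro: csup_upper)
next
  case (least A t)
  then show ?case by (auto simp: cimage.rep_eq intro: csup_least)
next
  case (distr A t)
  then show ?case by (simp add: cimage.rep_eq image_image csup_inf)
next
  case (disjoint q p)
  then have "inf (u p) (v q) = bot" using R unfolding respects_relations_def by blast
  then show ?case by simp
next
  case (cover p q)
  then have "sup (u p) (v q) = top" using R unfolding respects_relations_def by blast
  then show ?case by (simp add: cimage.rep_eq csup_insert2)
next
  case (lo_ge p r)
  then have "u r \<le> (SUP r\<in>{p<..}. u r)" by (intro csup_upper) auto
  also have "\<dots> = u p" using R unfolding respects_relations_def by metis
  finally show ?case by simp
next
  case (up_ge r q)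
  then have "v r \<le> (SUP s\<in>{..<q}. v s)" by (intro csup_upper) auto
  also have "\<dots> = v q" using R unfolding respects_relations_def by metis
  finally show ?case by simp
next
  case (lo_le p)
  have "u p = (SUP r\<in>{p<..}. u r)" using R unfolding respects_relations_def by metis
  then show ?case by (simp add: cimage.rep_eq image_image)
next
  case (up_le q)
  have "v q = (SUP s\<in>{..<q}. v s)" using R unfolding respects_relations_def by metis
  then show ?case by (simp add: cimage.rep_eq image_image)
next
  case lo_top
  have "(SUP p. u p) = top" using R unfolding respects_relations_def by metis
  then show ?case by (simp add: cimage.rep_eq image_image)
next
  case up_top
  have "(SUP q. v q) = top" using R unfolding respects_relations_def by metis
  then show ?case by (simp add: cimage.rep_eq image_image)
qed simp_all

lemma respects_relations_gen: "respects_relations lo up"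
proof -
  have lo: "lo p = abs_lreals (Lo p)" and up: "up p = abs_lreals (Up p)" for p
    by (simp_all add: lo_def up_def)
  have a: "inf (lo p) (up q) = bot" if "q \<le> p" for p q
    using rle.disjoint[OF that]
    by (intro antisym bot_least) (simp add: lo up inf_lreals.abs_eq bot_lreals_def abs_le_iff)
  have b: "sup (lo p) (up q) = top" if "p < q" for p q
    using rle.cover[OF that]
    by (intro antisym top_greatest) (simp add: lo up sup_lreals.abs_eq top_lreals_def abs_le_iff)
  have S: "(SUP p\<in>X. abs_lreals (C p)) = abs_lreals (Join (acset (C ` X)))"
    for C and X :: "rat set"
    by (simp add: abs_Join image_image)
  have c: "lo p = (SUP r\<in>{p<..}. lo r)" for p
    unfolding lo S lreals.abs_eq_iff req_def
    by (auto intro: rle.lo_le rle.lo_ge intro!: rle.least)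
  have d: "up q = (SUP s\<in>{..<q}. up s)" for q
    unfolding up S lreals.abs_eq_iff req_def
    by (auto intro: rle.up_le rle.up_ge intro!: rle.least)
  have e: "(SUP p. lo p) = top" "(SUP q. up q) = top"
    unfolding lo up S top_lreals_def lreals.abs_eq_iff req_def
    by (auto intro: rle.top rle.lo_top rle.up_top)
  show ?thesis unfolding respects_relations_def by (intro conjI allI impI a b c d e)
qed

lemma ext_unique:
  assumes R: "respects_relations u v"
  shows "\<exists>!h. h \<in> Meas \<and> (\<forall>p. h (lo p) = u p) \<and> (\<forall>q. h (up q) = v q)"
proof (rule ex_ex1I)
  define h where "h x = reval u v (rep_lreals x)" for x
  have h_abs: "h (abs_lreals s) = reval u v s" for s
    unfolding h_def by (intro antisym reval_mono[OF R] rle_rep_abs)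
  have lo: "lo p = abs_lreals (Lo p)" and up: "up p = abs_lreals (Up p)" for p
    by (simp_all add: lo_def up_def)
  have "h (inf x y) = inf (h x) (h y)" for x y
    using h_abs[of "Meet (rep_lreals x) (rep_lreals y)"]
    by (simp add: h_def inf_lreals_def)
  moreover have "h top = top"
    by (simp add: top_lreals_def h_abs)
  moreover have "h (Sup A) = (SUP a\<in>A. h a)" if "countable A" for A
    using that by (simp add: Sup_lreals_def h_abs cimage.rep_eq image_image flip: h_def)
  ultimately have "h \<in> Meas" by (simp add: Meas_def sigma_frame_hom_def)
  then show "\<exists>h. h \<in> Meas \<and> (\<forall>p. h (lo p) = u p) \<and> (\<forall>q. h (up q) = v q)"
    by (intro exI[of _ h]) (simp add: lo up h_abs)
next
  have lo: "lo p = abs_lreals (Lo p)" and up: "up p = abs_lreals (Up p)" for p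
    by (simp_all add: lo_def up_def)
  have *: "k (abs_lreals s) = reval u v s"
    if "k \<in> Meas \<and> (\<forall>p. k (lo p) = u p) \<and> (\<forall>q. k (up q) = v q)" for k s
  proof (induction s)
    case (Meet s t)
    moreover have "abs_lreals (Meet s t) = inf (abs_lreals s) (abs_lreals t)"
      by (simp add: inf_lreals.abs_eq)
    ultimately show ?case using that by (simp add: Meas_def sigma_frame_hom_def)
  next
    case (Join A)
    have "k (abs_lreals (Join A)) = (SUP s\<in>rcset A. k (abs_lreals s))"
      using that by (simp add: Meas_def sigma_frame_hom_def abs_Join image_image)
    also have "\<dots> = (SUP s\<in>rcset A. reval u v s)"
      using Join by (intro arg_cong[where f = Sup] image_cong refl) (simp add: cset.set_map)
    finally show ?case by (simp add: cimage.rep_eq)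
  qed (use that in \<open>simp_all add: lo up Meas_def sigma_frame_hom_def top_lreals_def\<close>)
  fix h k
  assume "h \<in> Meas \<and> (\<forall>p. h (lo p) = u p) \<and> (\<forall>q. h (up q) = v q)"
    and "k \<in> Meas \<and> (\<forall>p. k (lo p) = u p) \<and> (\<forall>q. k (up q) = v q)"
  then have "h (abs_lreals s) = k (abs_lreals s)" for s by (simp add: *)
  then show "h = k" by (metis abs_rep ext)
qed

end

theory Submission
  imports Defs
begin

text \<open>A function is simple iff it is locally constant: there is a finite cover of the top element
  by elements below each of which the function agrees with a rational constant. Pieces with different
  constants are automatically disjoint, so joining the pieces with equal constants gives a partition
  into complemented elements. Every operation is computed locally, and on constants it is the
  operation of the rationals; since the defining relations of the frame of reals can be checked
  locally too, the pointwise formulas define locally constant functions. Closure under the operations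
  then amounts to taking common refinements of covers.\<close>

section \<open>Gluing along covers\<close>

lemma inf_csup:
  fixes a :: "'a::sigma_frame"
  assumes "countable I"
  shows "inf a (SUP i\<in>I. x i) = (SUP i\<in>I. inf a (x i))"
  using csup_inf[of "x ` I" a] assms by (simp add: image_image inf.commute)

lemma inf_sup_distrib_sigma_frame:
  fixes a :: "'a::sigma_frame"
  shows "inf a (sup x y) = sup (inf a x) (inf a y)"
  using csup_inf[of "{x, y}" a] by (simp add: csup_insert2 inf.commute)

text \<open>Agreement of \<open>x\<close> and \<open>x'\<close> below \<open>a\<close> is expressed
  by \<open>inf a x = inf a x'\<close>. This lemma and the next two make agreement a congruence for
  the operations occurring in the defining relations.\<close>

lemma inf_local:
  fixes a :: "'a::sigma_frame"
  assumes "inf a x = inf a x'" "inf a y = inf a y'"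
  shows "inf a (inf x y) = inf a (inf x' y')"
  using assms by (metis inf.assoc inf.left_commute)

lemma sup_local:
  fixes a :: "'a::sigma_frame"
  assumes "inf a x = inf a x'" "inf a y = inf a y'"
  shows "inf a (sup x y) = inf a (sup x' y')"
  using assms by (simp add: inf_sup_distrib_sigma_frame)

lemma SUP_local:
  fixes a :: "'a::sigma_frame"
  assumes "countable I" "\<And>i. i \<in> I \<Longrightarrow> inf a (x i) = inf a (y i)"
  shows "inf a (SUP i\<in>I. x i) = inf a (SUP i\<in>I. y i)"
  using assms by (simp add: inf_csup cong: image_cong_simp)

text \<open>By countable distributivity \<open>x\<close> is the join of the elements
  \<open>inf a x\<close> over the cover, so it is determined by what it is below each
  \<open>a\<close>.\<close>

lemma eq_by_cover:
  fixes x y :: "'a::sigma_frame"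
  assumes "countable C" "Sup C = top" "\<And>a. a \<in> C \<Longrightarrow> inf a x = inf a y"
  shows "x = y"
proof -
  have "inf (Sup C) x = inf (Sup C) y"
    using assms(1,3) by (simp add: csup_inf cong: image_cong_simp)
  then show ?thesis by (simp add: assms(2))
qed

text \<open>Each defining relation is an equation built from binary meets and joins and countable
  joins, so it can be checked below each member of a cover. The reference pair \<open>u'\<close>,
  \<open>v'\<close> may vary from one member to the next.\<close>

lemma respects_relations_local:
  fixes u v :: "rat \<Rightarrow> 'a::sigma_frame"
  assumes C: "countable C" "Sup C = top"
    and loc: "\<And>a. a \<in> C \<Longrightarrow> \<exists>u' v'. respects_relations u' v' \<and>
      (\<forall>p. inf a (u p) = inf a (u' p)) \<and> (\<forall>q. inf a (v q) = inf a (v' q))"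
  shows "respects_relations u v"
proof -
  note eqI = eq_by_cover[OF C]
  have 1: "inf (u p) (v q) = bot" if "p \<ge> q" for p q
  proof (rule eqI)
    fix a assume "a \<in> C"
    from loc[OF this] obtain u' v' where *: "respects_relations u' v'"
      "\<And>p. inf a (u p) = inf a (u' p)" "\<And>q. inf a (v q) = inf a (v' q)" by blast
    have "inf a (inf (u p) (v q)) = inf a (inf (u' p) (v' q))"
      by (intro inf_local *)
    also have "inf (u' p) (v' q) = bot"
      using *(1) that unfolding respects_relations_def by blast
    finally show "inf a (inf (u p) (v q)) = inf a bot" .
  qed
  have 2: "sup (u p) (v q) = top" if "p < q" for p q
  proof (rule eqI)
    fix a assume "a \<in> C"
    from loc[OF this] obtain u' v' where *: "respects_relations u' v'"
      "\<And>p. inf a (u p) = inf a (u' p)" "\<And>q. inf a (v q) = inf a (v' q)" by blast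
    have "inf a (sup (u p) (v q)) = inf a (sup (u' p) (v' q))"
      by (intro sup_local *)
    also have "sup (u' p) (v' q) = top"
      using *(1) that unfolding respects_relations_def by blast
    finally show "inf a (sup (u p) (v q)) = inf a top" .
  qed
  have 3: "u p = (SUP r\<in>{p<..}. u r)" for p
  proof (rule eqI)
    fix a assume "a \<in> C"
    from loc[OF this] obtain u' v' where *: "respects_relations u' v'"
      "\<And>p. inf a (u p) = inf a (u' p)" "\<And>q. inf a (v q) = inf a (v' q)" by blast
    have "inf a (u p) = inf a (u' p)" by (rule *)
    also have "u' p = (SUP r\<in>{p<..}. u' r)"
      using *(1) unfolding respects_relations_def by blast
    also have "inf a \<dots> = inf a (SUP r\<in>{p<..}. u r)"
      by (intro SUP_local) (auto simp: *)
    finally show "inf a (u p) = inf a (SUP r\<in>{p<..}. u r)" .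
  qed
  have 4: "v q = (SUP s\<in>{..<q}. v s)" for q
  proof (rule eqI)
    fix a assume "a \<in> C"
    from loc[OF this] obtain u' v' where *: "respects_relations u' v'"
      "\<And>p. inf a (u p) = inf a (u' p)" "\<And>q. inf a (v q) = inf a (v' q)" by blast
    have "inf a (v q) = inf a (v' q)" by (rule *)
    also have "v' q = (SUP s\<in>{..<q}. v' s)"
      using *(1) unfolding respects_relations_def by blast
    also have "inf a \<dots> = inf a (SUP s\<in>{..<q}. v s)"
      by (intro SUP_local) (auto simp: *)
    finally show "inf a (v q) = inf a (SUP s\<in>{..<q}. v s)" .
  qed
  have 5: "(SUP p. u p) = top"
  proof (rule eqI)
    fix a assume "a \<in> C"
    from loc[OF this] obtain u' v' where *: "respects_relations u' v'"
      "\<And>p. inf a (u p) = inf a (u' p)" "\<And>q. inf a (v q) = inf a (v' q)" by blast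
    have "inf a (SUP p. u p) = inf a (SUP p. u' p)"
      by (intro SUP_local) (auto simp: *)
    also have "(SUP p. u' p) = top" using *(1) unfolding respects_relations_def by blast
    finally show "inf a (SUP p. u p) = inf a top" .
  qed
  have 6: "(SUP q. v q) = top"
  proof (rule eqI)
    fix a assume "a \<in> C"
    from loc[OF this] obtain u' v' where *: "respects_relations u' v'"
      "\<And>p. inf a (u p) = inf a (u' p)" "\<And>q. inf a (v q) = inf a (v' q)" by blast
    have "inf a (SUP q. v q) = inf a (SUP q. v' q)"
      by (intro SUP_local) (auto simp: *)
    also have "(SUP q. v' q) = top" using *(1) unfolding respects_relations_def by blast
    finally show "inf a (SUP q. v q) = inf a top" .
  qed
  show ?thesis
    unfolding respects_relations_def using 1 2 3 4 5 6 by blast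
qed

lemma ext_gen:
  assumes "respects_relations u v"
  shows "ext u v \<in> Meas" "ext u v (lo p) = u p" "ext u v (up q) = v q"
  using theI'[OF ext_unique[OF assms]] unfolding ext_def by blast+

text \<open>A homomorphism carries the relations that hold among the generators \<open>lo\<close>
  and \<open>up\<close> to its target. This is the converse of \<open>ext_gen\<close>.\<close>

lemma Meas_respects_relations:
  fixes h :: "lreals \<Rightarrow> 'a::sigma_frame"
  assumes "h \<in> Meas"
  shows "respects_relations (\<lambda>p. h (lo p)) (\<lambda>q. h (up q))"
proof -
  have top: "h top = top" and inf: "\<And>x y. h (inf x y) = inf (h x) (h y)"
    and Sup: "\<And>A. countable A \<Longrightarrow> h (Sup A) = (SUP a\<in>A. h a)"
    using assms by (auto simp: Meas_def sigma_frame_hom_def)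
  have bot: "h bot = bot"
    using Sup[of "{}"] by (simp add: csup_empty)
  have sup: "h (sup x y) = sup (h x) (h y)" for x y
    using Sup[of "{x, y}"] by (simp add: csup_insert2)
  have SUP: "h (SUP i\<in>I. x i) = (SUP i\<in>I. h (x i))" if "countable I" for I :: "rat set" and x
    using Sup[of "x ` I"] that by (simp add: image_image)
  note R = respects_relations_gen[unfolded respects_relations_def]
  have 1: "inf (h (lo p)) (h (up q)) = bot" if "p \<ge> q" for p q
    using R that by (metis inf bot)
  have 2: "sup (h (lo p)) (h (up q)) = top" if "p < q" for p q
    using R that by (metis sup top)
  have 3: "h (lo p) = (SUP r\<in>{p<..}. h (lo r))" for p
    using R by (metis SUP countableI_type countable_subset subset_UNIV)
  have 4: "h (up q) = (SUP s\<in>{..<q}. h (up s))" for q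
    using R by (metis SUP countableI_type countable_subset subset_UNIV)
  have "(SUP p. lo p) = top" "(SUP q. up q) = top"
    using R by blast+
  then have 5: "(SUP p. h (lo p)) = top" "(SUP q. h (up q)) = top"
    using SUP[of UNIV lo] SUP[of UNIV up] top by simp_all
  show ?thesis
    unfolding respects_relations_def using 1 2 3 4 5 by blast
qed

lemma Meas_eqI:
  assumes "f \<in> Meas" "g \<in> Meas" "\<And>p. f (lo p) = g (lo p)" "\<And>q. f (up q) = g (up q)"
  shows "f = g"
  using ext_unique[OF Meas_respects_relations[OF assms(2)]] assms by blast


section \<open>Functions that are constant below an element\<close>

text \<open>Says that the pair agrees with the constant \<open>r\<close> below \<open>a\<close>. It
  speaks of a pair of maps and not of a homomorphism, so that it can be applied to the formulas
  inside \<open>ext\<close> before these are known to define anything.\<close>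

definition const_on :: "'a::sigma_frame \<Rightarrow> rat \<Rightarrow> (rat \<Rightarrow> 'a) \<Rightarrow> (rat \<Rightarrow> 'a) \<Rightarrow> bool" where
  "const_on a r u v \<longleftrightarrow>
     (\<forall>p. inf a (u p) = (if p < r then a else bot)) \<and> (\<forall>q. inf a (v q) = (if r < q then a else bot))"

definition equals_on :: "'a::sigma_frame \<Rightarrow> rat \<Rightarrow> (lreals \<Rightarrow> 'a) \<Rightarrow> bool" where
  "equals_on a r f \<longleftrightarrow> const_on a r (\<lambda>p. f (lo p)) (\<lambda>q. f (up q))"

lemma equals_on_iff:
  "equals_on a r f \<longleftrightarrow>
     (\<forall>p. inf a (f (lo p)) = (if p < r then a else bot)) \<and> (\<forall>q. inf a (f (up q)) = (if r < q then a else bot))"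
  by (simp add: equals_on_def const_on_def)

text \<open>The locally constant functions. The cover may overlap, so refining covers amounts to
  taking pairwise meets; a partition into complemented pieces is recovered in
  \<open>step_imp_simple\<close>.\<close>

definition step :: "(lreals \<Rightarrow> 'a::sigma_frame) \<Rightarrow> bool" where
  "step f \<longleftrightarrow> f \<in> Meas \<and> (\<exists>C. finite C \<and> Sup C = top \<and> (\<forall>a\<in>C. \<exists>r. equals_on a r f))"

text \<open>Density of the rationals gives the two approximation relations; \<open>r - 1\<close> and
  \<open>r + 1\<close> witness the two unboundedness relations.\<close>

lemma respects_relations_const:
  "respects_relations (\<lambda>p. if p < r then top else bot :: 'a::sigma_frame)
     (\<lambda>q. if r < q then top else bot)"
proof -
  have 1: "(SUP s\<in>{p<..}. if s < r then top else bot :: 'a) = (if p < r then top else bot)" for p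
  proof (cases "p < r")
    case True
    then obtain s where "p < s" "s < r" using dense by blast
    then have "top \<le> (SUP s\<in>{p<..}. if s < r then top else bot :: 'a)"
      by (intro csup_upper) (auto intro!: image_eqI[of _ _ s])
    then show ?thesis using True by (simp add: top_unique)
  next
    case False
    then show ?thesis by (auto intro!: antisym csup_least)
  qed
  have 2: "(SUP s\<in>{..<q}. if r < s then top else bot :: 'a) = (if r < q then top else bot)" for q
  proof (cases "r < q")
    case True
    then obtain s where "r < s" "s < q" using dense by blast
    then have "top \<le> (SUP s\<in>{..<q}. if r < s then top else bot :: 'a)"
      by (intro csup_upper) (auto intro!: image_eqI[of _ _ s])
    then show ?thesis using True by (simp add: top_unique)
  next
    case False
    then show ?thesis by (auto intro!: antisym csup_least)
  qed
  have "top \<le> (SUP p. if p < r then top else bot :: 'a)"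
    by (intro csup_upper) (auto intro!: image_eqI[of _ _ "r - 1"])
  moreover have "top \<le> (SUP q. if r < q then top else bot :: 'a)"
    by (intro csup_upper) (auto intro!: image_eqI[of _ _ "r + 1"])
  ultimately show ?thesis
    unfolding respects_relations_def 1 2 by (auto simp: top_unique)
qed

lemma respects_relations_of_const_on:
  fixes u v :: "rat \<Rightarrow> 'a::sigma_frame"
  assumes "countable C" "Sup C = top" "\<And>a. a \<in> C \<Longrightarrow> \<exists>r. const_on a r u v"
  shows "respects_relations u v"
proof (rule respects_relations_local[OF assms(1,2)])
  fix a assume "a \<in> C"
  then obtain r where r: "const_on a r u v" using assms(3) by blast
  show "\<exists>u' v'. respects_relations u' v' \<and>
      (\<forall>p. inf a (u p) = inf a (u' p)) \<and> (\<forall>q. inf a (v q) = inf a (v' q))"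
    by (intro exI conjI, rule respects_relations_const[of r]) (use r in \<open>auto simp: const_on_def\<close>)
qed

text \<open>This is how formulas under \<open>ext\<close> are shown to be well defined: being
  constant below each member of a finite cover already forces the relations.\<close>

lemma step_ext:
  fixes u v :: "rat \<Rightarrow> 'a::sigma_frame"
  assumes "finite C" "Sup C = top" "\<And>a. a \<in> C \<Longrightarrow> \<exists>r. const_on a r u v"
  shows "respects_relations u v" "step (ext u v)"
proof -
  show R: "respects_relations u v"
    using assms by (intro respects_relations_of_const_on[of C]) (auto intro: countable_finite)
  show "step (ext u v)"
    unfolding step_def equals_on_def using assms by (auto simp: ext_gen[OF R])
qed

lemma equals_on_mono:
  assumes "equals_on a r f" "b \<le> a"
  shows "equals_on b r f"
proof -
  have "inf b x = inf b (inf a x)" for x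
    using assms(2) by (metis inf.absorb1 inf.assoc)
  then have "inf b (f (lo p)) = inf b (if p < r then a else bot)"
    and "inf b (f (up q)) = inf b (if r < q then a else bot)" for p q
    using assms(1) unfolding equals_on_iff by metis+
  then show ?thesis using assms(2) by (simp add: equals_on_iff inf.absorb1)
qed

lemma common_refinement_ex:
  assumes "finite F" "\<And>f. f \<in> F \<Longrightarrow> step f"
  shows "\<exists>C. finite C \<and> Sup C = (top :: 'a::sigma_frame) \<and> (\<forall>a\<in>C. \<forall>f\<in>F. \<exists>r. equals_on a r f)"
  using assms
proof (induction F)
  case empty
  show ?case
    by (rule exI[of _ "{top}"]) (use csup_insert2[of top top] in simp)
next
  case (insert f F)
  obtain C where C: "finite C" "Sup C = top" "\<And>a g. a \<in> C \<Longrightarrow> g \<in> F \<Longrightarrow> \<exists>r. equals_on a r g"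
    using insert by auto
  obtain D where D: "finite D" "Sup D = top" "\<And>a. a \<in> D \<Longrightarrow> \<exists>r. equals_on a r f"
    using insert.prems[of f] unfolding step_def by blast
  define E where "E = (\<lambda>(a, b). inf a b) ` (C \<times> D)"
  have fin: "finite E" using C D by (simp add: E_def)
  \<comment> \<open>Two nested cover arguments: \<open>Sup E\<close> is compared with
    \<open>top\<close> below each \<open>a\<close> of \<open>C\<close>, and there below each
    \<open>b\<close> of \<open>D\<close>, where \<open>inf a b\<close> belongs to
    \<open>E\<close>.\<close>
  have "inf a (Sup E) = inf a top" if "a \<in> C" for a
  proof (rule eq_by_cover[OF countable_finite[OF D(1)] D(2)])
    fix b assume "b \<in> D"
    then have "inf a b \<in> E" using that by (auto simp: E_def)
    then have "inf a b \<le> Sup E" by (rule csup_upper[OF countable_finite[OF fin]])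
    then have "inf (inf b a) (Sup E) = inf b a" by (simp only: inf.absorb1 inf.commute[of b a])
    then show "inf b (inf a (Sup E)) = inf b (inf a top)"
      by (simp only: inf.assoc inf_top_right)
  qed
  then have "Sup E = top"
    by (rule eq_by_cover[OF countable_finite[OF C(1)] C(2)])
  moreover have "\<exists>r. equals_on c r g" if c: "c \<in> E" and "g \<in> insert f F" for c g
  proof -
    obtain a b where ab: "a \<in> C" "b \<in> D" "c = inf a b"
      using c by (auto simp: E_def)
    show ?thesis
    proof (cases "g = f")
      case True
      then show ?thesis using D(3)[of b] ab by (auto intro: equals_on_mono[OF _ inf.cobounded2])
    next
      case False
      then show ?thesis using C(3)[of a g] that ab by (auto intro: equals_on_mono[OF _ inf.cobounded1])
    qed
  qed
  ultimately show ?case using fin by blast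
qed

lemma common_refinement:
  fixes F :: "(lreals \<Rightarrow> 'a::sigma_frame) set"
  assumes "finite F" "\<And>f. f \<in> F \<Longrightarrow> step f"
  obtains C where "finite C" "Sup C = top"
    "\<And>a f. a \<in> C \<Longrightarrow> f \<in> F \<Longrightarrow> \<exists>r. equals_on a r f"
  using common_refinement_ex[OF assms] by blast

lemma step_Meas: "step f \<Longrightarrow> f \<in> Meas"
  by (simp add: step_def)

lemma equals_on_agree:
  assumes "equals_on a r f" "equals_on a r g"
  shows "inf a (f (lo p)) = inf a (g (lo p))" "inf a (f (up q)) = inf a (g (up q))"
  using assms by (simp_all add: const_on_def equals_on_iff)

lemma eq_if_equals_on:
  assumes "f \<in> Meas" "g \<in> Meas" "finite C" "Sup C = top"
    and "\<And>a. a \<in> C \<Longrightarrow> \<exists>r. equals_on a r f \<and> equals_on a r g"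
  shows "f = g"
proof (rule Meas_eqI[OF assms(1,2)])
  note eqI = eq_by_cover[OF countable_finite[OF assms(3)] assms(4)]
  show "f (lo p) = g (lo p)" for p
    by (rule eqI) (use assms(5) equals_on_agree(1) in blast)
  show "f (up q) = g (up q)" for q
    by (rule eqI) (use assms(5) equals_on_agree(2) in blast)
qed

text \<open>The generator \<open>lo r\<close> separates the two constants: \<open>f (lo r)\<close>
  meets \<open>a\<close> in \<open>bot\<close> but contains \<open>b\<close>, because
  \<open>r < s\<close>.\<close>

lemma equals_on_disjoint:
  assumes "equals_on a r f" "equals_on b s f" "r < s"
  shows "inf a b = bot"
proof -
  have "inf a (f (lo r)) = bot" "inf b (f (lo r)) = b"
    using assms by (simp_all add: const_on_def equals_on_iff)
  then show ?thesis
    by (metis inf.left_commute inf_bot_right)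
qed

lemma equals_on_bot: "equals_on bot r f"
  by (simp add: const_on_def equals_on_iff)

text \<open>Here \<open>\<phi>\<close> is the operation that the formula induces on rational
  constants. The last conclusion holds below every \<open>a\<close> on which \<open>f\<close> is
  constant, not just below members of a chosen cover.\<close>

lemma step_ext1:
  assumes "step f" and loc: "\<And>a r. equals_on a r f \<Longrightarrow> const_on a (\<phi> r) u v"
  shows "respects_relations u v" "step (ext u v)"
    and "equals_on a r f \<Longrightarrow> equals_on a (\<phi> r) (ext u v)"
proof -
  obtain C where C: "finite C" "Sup C = top" "\<And>a. a \<in> C \<Longrightarrow> \<exists>r. equals_on a r f"
    using assms(1) unfolding step_def by blast
  have D: "\<exists>r. const_on a r u v" if "a \<in> C" for a
    using C(3)[OF that] by (elim exE) (rule exI, rule loc)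
  show R: "respects_relations u v" and "step (ext u v)"
    using step_ext[OF C(1,2) D] by auto
  show "equals_on a r f \<Longrightarrow> equals_on a (\<phi> r) (ext u v)"
    using loc by (simp add: equals_on_def[of _ _ "ext u v"] ext_gen[OF R])
qed

lemma step_ext2:
  assumes "step f" "step g"
    and loc: "\<And>a r s. equals_on a r f \<Longrightarrow> equals_on a s g \<Longrightarrow> const_on a (\<phi> r s) u v"
  shows "step (ext u v)"
proof -
  obtain C where C: "finite C" "Sup C = top" "\<And>a h. a \<in> C \<Longrightarrow> h \<in> {f, g} \<Longrightarrow> \<exists>r. equals_on a r h"
    by (rule common_refinement[of "{f, g}"]) (use assms(1,2) in auto)
  have D: "\<exists>r. const_on a r u v" if a: "a \<in> C" for a
  proof -
    obtain r s where "equals_on a r f" "equals_on a s g"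
      using C(3)[OF a, of f] C(3)[OF a, of g] by auto
    then show ?thesis by (intro exI) (rule loc)
  qed
  show ?thesis by (rule step_ext(2)[OF C(1,2) D])
qed


section \<open>The operations on locally constant functions\<close>

lemma
  fixes a :: "'a::sigma_frame"
  shows step_mconst: "step (mconst r :: lreals \<Rightarrow> 'a)"
    and equals_on_mconst: "equals_on a r (mconst r)"
proof -
  have *: "equals_on b r (mconst r)" for b :: 'a
    unfolding mconst_def by (simp add: ext_gen[OF respects_relations_const] const_on_def equals_on_iff)
  then show "equals_on a r (mconst r)" .
  have "mconst r \<in> (Meas :: (lreals \<Rightarrow> 'a) set)"
    unfolding mconst_def by (rule ext_gen[OF respects_relations_const])
  then show "step (mconst r :: lreals \<Rightarrow> 'a)"
    unfolding step_def using * csup_insert2[of top "top :: 'a"]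
    by (intro conjI exI[of _ "{top}"]) auto
qed

lemma mconst_gen:
  "mconst r (lo p) = (if p < r then top else bot :: 'a::sigma_frame)"
  "mconst r (up q) = (if r < q then top else bot :: 'a)"
  unfolding mconst_def by (simp_all add: ext_gen[OF respects_relations_const])

lemma
  assumes "step f"
  shows step_mneg: "step (mneg f)"
    and equals_on_mneg: "equals_on a r f \<Longrightarrow> equals_on a (- r) (mneg f)"
proof -
  have "const_on a (- r) (\<lambda>p. f (up (- p))) (\<lambda>q. f (lo (- q)))" if "equals_on a r f" for a r
    using that by (auto simp: const_on_def equals_on_iff)
  note * = step_ext1[OF assms this]
  show "step (mneg f)"
    unfolding mneg_def by (rule *(2))
  show "equals_on a r f \<Longrightarrow> equals_on a (- r) (mneg f)"
    unfolding mneg_def by (rule *(3))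
qed

lemma
  assumes "step f" "c > 0"
  shows step_pscale: "step (pscale c f)"
    and equals_on_pscale: "equals_on a r f \<Longrightarrow> equals_on a (c * r) (pscale c f)"
proof -
  have "const_on a (c * r) (\<lambda>p. f (lo (p / c))) (\<lambda>q. f (up (q / c)))" if "equals_on a r f" for a r
    using that assms(2)
    by (simp add: const_on_def equals_on_iff pos_divide_less_eq pos_less_divide_eq mult.commute)
  note * = step_ext1[OF assms(1) this]
  show "step (pscale c f)"
    unfolding pscale_def by (rule *(2))
  show "equals_on a r f \<Longrightarrow> equals_on a (c * r) (pscale c f)"
    unfolding pscale_def by (rule *(3))
qed

lemma step_mscale:
  assumes "step f"
  shows "step (mscale c f)"
  using assms by (auto simp: mscale_def step_pscale step_mneg step_mconst)

lemma equals_on_mscale: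
  assumes "step f" "equals_on a r f"
  shows "equals_on a (c * r) (mscale c f)"
proof -
  consider "c > 0" | "c = 0" | "c < 0" by linarith
  then show ?thesis
  proof cases
    case 3
    then have "equals_on a (- (- c * r)) (mneg (pscale (- c) f))"
      by (intro equals_on_mneg equals_on_pscale step_pscale assms) auto
    then show ?thesis using 3 by (simp add: mscale_def)
  qed (use assms equals_on_pscale equals_on_mconst[of a 0] in \<open>auto simp: mscale_def\<close>)
qed

section \<open>Positive parts and products\<close>

lemma
  assumes "step f"
  shows step_pos: "step (pos f)"
    and pos_up_0: "pos f (up 0) = bot"
proof -
  have "const_on a (max r 0) (\<lambda>p. sup (f (lo p)) (mconst 0 (lo p))) (\<lambda>q. inf (f (up q)) (mconst 0 (up q)))"
    if "equals_on a r f" for a r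
    using that by (auto simp: const_on_def equals_on_iff mconst_gen inf_sup_distrib_sigma_frame)
  note * = step_ext1[OF assms this]
  show "step (pos f)"
    unfolding pos_def mjoin_def by (rule *(2))
  have "pos f (up 0) = inf (f (up 0)) (mconst 0 (up 0))"
    unfolding pos_def mjoin_def by (rule ext_gen(3)[OF *(1)])
  then show "pos f (up 0) = bot" by (simp add: mconst_gen)
qed

lemma npos_eq: "npos f = pos (mneg f)"
  by (simp add: npos_def pos_def)

text \<open>The condition \<open>f (up 0) = bot\<close> says that \<open>f\<close> is nonnegative. A negative constant is then possible
  only below \<open>bot\<close>, where \<open>f\<close> equals every constant.\<close>

lemma equals_on_nonneg:
  assumes "equals_on a r f" "f (up 0) = bot"
  shows "equals_on a (max r 0) f"
proof (cases "r < 0")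
  case True
  then have "a = bot" using assms by (auto simp: const_on_def equals_on_iff split: if_splits dest: spec[of _ 0])
  then show ?thesis by (simp add: equals_on_bot)
qed (use assms in simp)

lemma ptimes_const_on:
  fixes f g :: "lreals \<Rightarrow> 'a::sigma_frame"
  assumes f: "equals_on a r f" and g: "equals_on a s g" and "r \<ge> 0" "s \<ge> 0"
  shows "const_on a (r * s)
    (\<lambda>p. if p < 0 then top else (SUP t\<in>{0<..}. inf (f (lo t)) (g (lo (p / t)))))
    (\<lambda>q. if q \<le> 0 then bot else (SUP t\<in>{0<..}. inf (f (up t)) (g (up (q / t)))))"
proof -
  have L: "inf a (inf (f (lo t)) (g (lo p))) = (if t < r \<and> p < s then a else bot)" for t p
    using f g by (simp add: const_on_def equals_on_iff inf.assoc[symmetric])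
  have U: "inf a (inf (f (up t)) (g (up q))) = (if r < t \<and> s < q then a else bot)" for t q
    using f g by (simp add: const_on_def equals_on_iff inf.assoc[symmetric])
  \<comment> \<open>Below \<open>a\<close> every term of the joins is \<open>a\<close> or
    \<open>bot\<close>, so evaluating a join becomes a question of existence about rationals,
    answered by \<open>lo\<close> and \<open>up\<close> below.\<close>
  have SUP: "(SUP t\<in>{0<..}. if P t then a else bot) = (if \<exists>t>0. P t then a else bot)"
    for P :: "rat \<Rightarrow> bool"
  proof (cases "\<exists>t>0. P t")
    case True
    then obtain t where "t > 0" "P t" by blast
    then have "a \<le> (SUP t\<in>{0<..}. if P t then a else bot)"
      by (intro csup_upper) (auto intro!: image_eqI[of _ _ t])
    then show ?thesis using True by (auto intro!: antisym csup_least)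
  next
    case False
    then show ?thesis by (auto intro!: antisym csup_least)
  qed
  have lo: "(\<exists>t>0. t < r \<and> p / t < s) \<longleftrightarrow> p < r * s" if "p \<ge> 0" for p
  proof
    assume "\<exists>t>0. t < r \<and> p / t < s"
    then obtain t where t: "t > 0" "t < r" "p < s * t" by (auto simp: divide_simps)
    note t(3)
    also have "s * t \<le> s * r" using t \<open>s \<ge> 0\<close> by (intro mult_left_mono) auto
    finally show "p < r * s" by (simp add: mult.commute)
  next
    assume *: "p < r * s"
    then have "s > 0" using that \<open>s \<ge> 0\<close> by (cases "s = 0") auto
    then have "p / s < r" using * by (simp add: divide_simps)
    \<comment> \<open>Any \<open>t\<close> strictly between \<open>p / s\<close> and
      \<open>r\<close> works; it is positive because \<open>p / s\<close> is nonnegative.\<close>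
    then obtain t where t: "p / s < t" "t < r" using dense by blast
    moreover have "0 \<le> p / s" using that \<open>s > 0\<close> by simp
    with t have "t > 0" by linarith
    ultimately show "\<exists>t>0. t < r \<and> p / t < s"
      using \<open>s > 0\<close> by (intro exI[of _ t]) (auto simp: divide_simps mult.commute)
  qed
  have up: "(\<exists>t>0. r < t \<and> s < q / t) \<longleftrightarrow> r * s < q" if "q > 0" for q
  proof
    assume "\<exists>t>0. r < t \<and> s < q / t"
    then obtain t where t: "t > 0" "r < t" "s * t < q" by (auto simp: divide_simps)
    then have "s * r \<le> s * t" using \<open>s \<ge> 0\<close> by (intro mult_left_mono) auto
    then show "r * s < q" using t by (simp add: mult.commute)
  next
    assume *: "r * s < q"
    show "\<exists>t>0. r < t \<and> s < q / t"
    \<comment> \<open>For \<open>s = 0\<close> the bound \<open>q / s\<close> carries no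
      information, but any positive \<open>t > r\<close> serves because \<open>q / t\<close> is
      positive.\<close>
    proof (cases "s = 0")
      case True
      then show ?thesis using \<open>r \<ge> 0\<close> that by (intro exI[of _ "r + 1"]) auto
    next
      case False
      then have "s > 0" using \<open>s \<ge> 0\<close> by simp
      then have "r < q / s" using * by (simp add: divide_simps)
      then obtain t where "r < t" "t < q / s" using dense by blast
      then show ?thesis
        using \<open>s > 0\<close> \<open>r \<ge> 0\<close> by (intro exI[of _ t]) (auto simp: divide_simps mult.commute)
    qed
  qed
  have "r * s \<ge> 0" using assms by simp
  show ?thesis
    unfolding const_on_def equals_on_iff
  proof (intro conjI allI)
    show "inf a (if p < 0 then top else (SUP t\<in>{0<..}. inf (f (lo t)) (g (lo (p / t))))) =
        (if p < r * s then a else bot)" for p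
    proof (cases "p < 0")
      case True
      then show ?thesis using \<open>r * s \<ge> 0\<close> by simp
    next
      case False
      then show ?thesis using lo[of p] by (simp add: inf_csup L SUP del: if_image_distrib)
    qed
    show "inf a (if q \<le> 0 then bot else (SUP t\<in>{0<..}. inf (f (up t)) (g (up (q / t))))) =
        (if r * s < q then a else bot)" for q
    proof (cases "q \<le> 0")
      case True
      then show ?thesis using \<open>r * s \<ge> 0\<close> by simp
    next
      case False
      then show ?thesis using up[of q] by (simp add: inf_csup U SUP del: if_image_distrib)
    qed
  qed
qed

lemma step_ptimes:
  assumes "step f" "step g" "f (up 0) = bot" "g (up 0) = bot"
  shows "step (ptimes f g)"
  unfolding ptimes_def
\<comment> \<open>The rule quantifies over all \<open>a\<close>, including \<open>bot\<close>, where
  negative \<open>r\<close> and \<open>s\<close> occur; truncating at 0 covers these.\<close>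
proof (rule step_ext2[OF assms(1,2), where \<phi> = "\<lambda>r s. max r 0 * max s 0"])
  fix a r s
  assume r: "equals_on a r f" and s: "equals_on a s g"
  show "const_on a (max r 0 * max s 0)
    (\<lambda>p. if p < 0 then top else (SUP t\<in>{0<..}. inf (f (lo t)) (g (lo (p / t)))))
    (\<lambda>q. if q \<le> 0 then bot else (SUP t\<in>{0<..}. inf (f (up t)) (g (up (q / t)))))"
    by (rule ptimes_const_on[OF equals_on_nonneg[OF r assms(3)] equals_on_nonneg[OF s assms(4)]])
      simp_all
qed

section \<open>Sums\<close>

text \<open>Below \<open>a\<close>, adding \<open>f\<close> is adding the constant \<open>r\<close>,
  which translates \<open>g\<close>: for \<open>t < r\<close> the argument \<open>p - t\<close> runs
  through all rationals above \<open>p - r\<close>, and the approximation relation for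
  \<open>g\<close> evaluates the join. \<open>g\<close> stays arbitrary for the sake of
  \<open>mneg_unique\<close>.\<close>

lemma SUP_sum_local:
  fixes f g :: "lreals \<Rightarrow> 'a::sigma_frame"
  assumes f: "equals_on a r f" and g: "g \<in> Meas"
  shows "inf a (SUP t. inf (f (lo t)) (g (lo (p - t)))) = inf a (g (lo (p - r)))"
    and "inf a (SUP t. inf (f (up t)) (g (up (q - t)))) = inf a (g (up (q - r)))"
proof -
  note R = Meas_respects_relations[OF g, unfolded respects_relations_def]
  have lo: "g (lo p) = (SUP s\<in>{p<..}. g (lo s))" for p
    using R by blast
  have up: "g (up q) = (SUP s\<in>{..<q}. g (up s))" for q
    using R by blast
  have lo_mono: "g (lo s) \<le> g (lo p)" if "p < s" for p s
    unfolding lo[of p] using that by (intro csup_upper) auto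
  have up_mono: "g (up s) \<le> g (up q)" if "s < q" for q s
    unfolding up[of q] using that by (intro csup_upper) auto
  have "inf a (SUP t. inf (f (lo t)) (g (lo (p - t)))) =
      inf a (SUP t. inf (if t < r then top else bot) (g (lo (p - t))))"
    using f by (intro SUP_local inf_local) (auto simp: const_on_def equals_on_iff)
  also have "(SUP t. inf (if t < r then top else bot) (g (lo (p - t)))) = g (lo (p - r))"
  proof (intro antisym)
    show "(SUP t. inf (if t < r then top else bot) (g (lo (p - t)))) \<le> g (lo (p - r))"
      by (intro csup_least) (auto intro!: lo_mono)
    have "g (lo s) \<le> (SUP t. inf (if t < r then top else bot) (g (lo (p - t))))"
      if "s \<in> {p - r<..}" for s
      \<comment> \<open>The index \<open>t = p - s\<close> lies below \<open>r\<close> and gives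
        \<open>p - t = s\<close>.\<close>
      using that by (intro csup_upper) (auto intro!: image_eqI[of _ _ "p - s"])
    then show "g (lo (p - r)) \<le> (SUP t. inf (if t < r then top else bot) (g (lo (p - t))))"
      unfolding lo[of "p - r"] by (intro csup_least) auto
  qed
  finally show "inf a (SUP t. inf (f (lo t)) (g (lo (p - t)))) = inf a (g (lo (p - r)))" .
  have "inf a (SUP t. inf (f (up t)) (g (up (q - t)))) =
      inf a (SUP t. inf (if r < t then top else bot) (g (up (q - t))))"
    using f by (intro SUP_local inf_local) (auto simp: const_on_def equals_on_iff)
  also have "(SUP t. inf (if r < t then top else bot) (g (up (q - t)))) = g (up (q - r))"
  proof (intro antisym)
    show "(SUP t. inf (if r < t then top else bot) (g (up (q - t)))) \<le> g (up (q - r))"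
      by (intro csup_least) (auto intro!: up_mono)
    have "g (up s) \<le> (SUP t. inf (if r < t then top else bot) (g (up (q - t))))"
      if "s \<in> {..<q - r}" for s
      using that by (intro csup_upper) (auto intro!: image_eqI[of _ _ "q - s"])
    then show "g (up (q - r)) \<le> (SUP t. inf (if r < t then top else bot) (g (up (q - t))))"
      unfolding up[of "q - r"] by (intro csup_least) auto
  qed
  finally show "inf a (SUP t. inf (f (up t)) (g (up (q - t)))) = inf a (g (up (q - r)))" .
qed

text \<open>Translation by \<open>r\<close> is an order automorphism of the rationals, and the
  relations mention only their order.\<close>

lemma respects_relations_shift:
  fixes u v :: "rat \<Rightarrow> 'a::sigma_frame"
  assumes "respects_relations u v"
  shows "respects_relations (\<lambda>p. u (p - r)) (\<lambda>q. v (q - r))"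
proof -
  have "(\<lambda>x. x - r) ` {p<..} = {p - r<..}" for p
    by (auto intro: image_eqI[of x _ "x + r" for x])
  then have 1: "(SUP s\<in>{p<..}. u (s - r)) = (SUP s\<in>{p - r<..}. u s)" for p
    by (metis image_image)
  have "(\<lambda>x. x - r) ` {..<q} = {..<q - r}" for q
    by (auto intro: image_eqI[of x _ "x + r" for x])
  then have 2: "(SUP s\<in>{..<q}. v (s - r)) = (SUP s\<in>{..<q - r}. v s)" for q
    by (metis image_image)
  have "range (\<lambda>x. x - r) = UNIV"
    by (auto intro: image_eqI[of x _ "x + r" for x])
  then have 3: "(SUP s. w (s - r)) = (SUP s. w s)" for w :: "rat \<Rightarrow> 'a"
    by (metis image_image)
  show ?thesis
    using assms unfolding respects_relations_def 1 2 3
    by (metis diff_right_mono diff_strict_right_mono)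
qed

lemma
  fixes f g :: "lreals \<Rightarrow> 'a::sigma_frame"
  assumes f: "step f" and g: "g \<in> Meas"
  shows madd_Meas: "madd f g \<in> Meas"
    and madd_local: "equals_on a r f \<Longrightarrow> inf a (madd f g (lo p)) = inf a (g (lo (p - r)))"
      "equals_on a r f \<Longrightarrow> inf a (madd f g (up q)) = inf a (g (up (q - r)))"
proof -
  obtain C where C: "finite C" "Sup C = top" "\<And>a. a \<in> C \<Longrightarrow> \<exists>r. equals_on a r f"
    using f unfolding step_def by blast
  have R: "respects_relations (\<lambda>p. SUP t. inf (f (lo t)) (g (lo (p - t))))
     (\<lambda>q. SUP t. inf (f (up t)) (g (up (q - t))))"
  proof (rule respects_relations_local[of C])
    fix a assume "a \<in> C"
    then obtain r where "equals_on a r f" using C by blast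
    note * = SUP_sum_local[OF this g]
    show "\<exists>u' v'. respects_relations u' v' \<and>
      (\<forall>p. inf a (SUP t. inf (f (lo t)) (g (lo (p - t)))) = inf a (u' p)) \<and>
      (\<forall>q. inf a (SUP t. inf (f (up t)) (g (up (q - t)))) = inf a (v' q))"
      by (intro exI conjI, rule respects_relations_shift[OF Meas_respects_relations[OF g], of r])
        (simp_all add: *)
  qed (use C in \<open>simp_all add: countable_finite\<close>)
  show "madd f g \<in> Meas"
    "equals_on a r f \<Longrightarrow> inf a (madd f g (lo p)) = inf a (g (lo (p - r)))"
    "equals_on a r f \<Longrightarrow> inf a (madd f g (up q)) = inf a (g (up (q - r)))"
    unfolding madd_def ext_gen(2,3)[OF R]
    by (simp_all only: ext_gen(1)[OF R] SUP_sum_local[OF _ g])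
qed

lemma equals_on_madd:
  assumes "step f" "g \<in> Meas" "equals_on a r f" "equals_on a s g"
  shows "equals_on a (r + s) (madd f g)"
  using assms(4) unfolding equals_on_iff madd_local[OF assms(1-3)]
  by (auto simp: algebra_simps)

lemma step_madd:
  assumes "step f" "step g"
  shows "step (madd f g)"
proof -
  obtain C where C: "finite C" "Sup C = top" "\<And>a h. a \<in> C \<Longrightarrow> h \<in> {f, g} \<Longrightarrow> \<exists>r. equals_on a r h"
    by (rule common_refinement[of "{f, g}"]) (use assms in auto)
  have "\<exists>r. equals_on a r (madd f g)" if a: "a \<in> C" for a
  proof -
    obtain r s where "equals_on a r f" "equals_on a s g"
      using C(3)[OF a, of f] C(3)[OF a, of g] by auto
    then show ?thesis
      using equals_on_madd[OF assms(1) step_Meas[OF assms(2)]] by blast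
  qed
  then show ?thesis
    unfolding step_def using madd_Meas[OF assms(1) step_Meas[OF assms(2)]] C(1,2) by blast
qed

lemma step_mmult: "step f \<Longrightarrow> step g \<Longrightarrow> step (mmult f g)"
  unfolding mmult_def npos_eq by (intro step_madd step_mneg step_ptimes step_pos pos_up_0)

lemma step_modulus: "step f \<Longrightarrow> step (modulus f)"
  unfolding modulus_def npos_eq by (intro step_madd step_mneg step_pos)

section \<open>Laws of addition on locally constant functions\<close>

text \<open>On a common refinement this is the law for rationals. It is the form of commutativity
  that folding over a finite set requires.\<close>

lemma madd_left_commute:
  assumes "step f" "step g" "step h"
  shows "madd f (madd g h) = madd g (madd f h)"
proof -
  obtain C where C: "finite C" "Sup C = top"
    "\<And>a k. a \<in> C \<Longrightarrow> k \<in> {f, g, h} \<Longrightarrow> \<exists>r. equals_on a r k"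
    by (rule common_refinement[of "{f, g, h}"]) (use assms in auto)
  show ?thesis
  proof (rule eq_if_equals_on[OF _ _ C(1,2)])
    fix a assume "a \<in> C"
    then obtain r s t where "equals_on a r f" "equals_on a s g" "equals_on a t h"
      using C(3)[of a f] C(3)[of a g] C(3)[of a h] by auto
    then have "equals_on a (r + (s + t)) (madd f (madd g h))"
      "equals_on a (s + (r + t)) (madd g (madd f h))"
      using assms by (auto intro!: equals_on_madd step_Meas step_madd)
    then show "\<exists>r. equals_on a r (madd f (madd g h)) \<and> equals_on a r (madd g (madd f h))"
      by (auto simp: add.left_commute)
  qed (use assms in \<open>auto intro: step_Meas step_madd\<close>)
qed

lemma madd_mneg:
  assumes "step f"
  shows "madd f (mneg f) = mconst 0" "madd (mneg f) f = mconst 0"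
proof -
  obtain C where C: "finite C" "Sup C = top" "\<And>a. a \<in> C \<Longrightarrow> \<exists>r. equals_on a r f"
    using assms unfolding step_def by blast
  show "madd f (mneg f) = mconst 0"
  proof (rule eq_if_equals_on[OF _ _ C(1,2)])
    fix a assume "a \<in> C"
    then obtain r where "equals_on a r f" using C(3) by blast
    then have "equals_on a (r + - r) (madd f (mneg f))"
      using assms by (intro equals_on_madd step_Meas step_mneg equals_on_mneg) auto
    then show "\<exists>r. equals_on a r (madd f (mneg f)) \<and> equals_on a r (mconst 0)"
      using equals_on_mconst by (intro exI[of _ 0]) auto
  qed (use assms in \<open>auto intro: step_Meas step_madd step_mneg step_mconst\<close>)
  show "madd (mneg f) f = mconst 0"
  proof (rule eq_if_equals_on[OF _ _ C(1,2)])
    fix a assume "a \<in> C"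
    then obtain r where "equals_on a r f" using C(3) by blast
    then have "equals_on a (- r + r) (madd (mneg f) f)"
      using assms by (intro equals_on_madd step_Meas step_mneg equals_on_mneg) auto
    then show "\<exists>r. equals_on a r (madd (mneg f) f) \<and> equals_on a r (mconst 0)"
      using equals_on_mconst by (intro exI[of _ 0]) auto
  qed (use assms in \<open>auto intro: step_Meas step_madd step_mneg step_mconst\<close>)
qed

text \<open>Where \<open>f\<close> is the constant \<open>r\<close>, the sum is \<open>g\<close>
  translated by \<open>r\<close>; hence \<open>g\<close> is the zero function translated back, the
  constant \<open>- r\<close>. That \<open>g\<close> ranges over all of \<open>Meas\<close> matters,
  since additive inverses in \<open>Meas_ring\<close> are sought there.\<close>

lemma mneg_unique:
  assumes f: "step f" and g: "g \<in> Meas" and "madd f g = mconst 0"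
  shows "g = mneg f"
proof -
  obtain C where C: "finite C" "Sup C = top" "\<And>a. a \<in> C \<Longrightarrow> \<exists>r. equals_on a r f"
    using f unfolding step_def by blast
  show ?thesis
  proof (rule eq_if_equals_on[OF _ _ C(1,2)])
    fix a assume "a \<in> C"
    then obtain r where r: "equals_on a r f" using C(3) by blast
    \<comment> \<open>Evaluating the sum at \<open>p + r\<close> cancels the translation in
      \<open>madd_local\<close>.\<close>
    have "inf a (g (lo p)) = inf a (mconst 0 (lo (p + r)))"
      "inf a (g (up p)) = inf a (mconst 0 (up (p + r)))" for p
      using madd_local[OF f g r, of "p + r"] assms(3) by simp_all
    then have "equals_on a (- r) g"
      by (auto simp: const_on_def equals_on_iff mconst_gen)
    then show "\<exists>r. equals_on a r g \<and> equals_on a r (mneg f)"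
      using equals_on_mneg[OF f r] by blast
  qed (use assms in \<open>auto intro: step_Meas step_mneg\<close>)
qed

section \<open>Finite sums\<close>

text \<open>\<open>finsum\<close> folds over all of \<open>Meas\<close>. Restricting the fold to the locally constant functions
  makes the laws of addition on these sufficient for computing it.\<close>

lemma foldSetD_restrict:
  assumes "(A, x) \<in> foldSetD D f e" "e \<in> E" "\<And>i y. i \<in> A \<Longrightarrow> y \<in> E \<Longrightarrow> f i y \<in> E"
  shows "(A, x) \<in> foldSetD E f e"
  using assms
proof (induction rule: foldSetD.induct)
  case (insertI i A y)
  then have "(A, y) \<in> foldSetD E f e" by blast
  moreover from this have "y \<in> E" by (rule foldSetD_closed)
  ultimately show ?case using insertI by (intro foldSetD.insertI) auto
qed (rule foldSetD.emptyI)

text \<open>\<open>foldD\<close> picks the value related to \<open>A\<close> by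
  \<open>foldSetD\<close>, so it suffices that both domains give the same relation at
  \<open>A\<close>.\<close>

lemma foldD_restrict:
  assumes "E \<subseteq> D" "e \<in> E" "\<And>i y. i \<in> A \<Longrightarrow> y \<in> E \<Longrightarrow> f i y \<in> E"
  shows "foldD D f e A = foldD E f e A"
proof -
  have "(A, x) \<in> foldSetD D f e" if "(A, x) \<in> foldSetD E f e" for x
    using that assms(1) by (induction rule: foldSetD.induct) (auto intro: foldSetD.intros)
  moreover have "(A, x) \<in> foldSetD E f e" if "(A, x) \<in> foldSetD D f e" for x
    by (rule foldSetD_restrict[OF that assms(2)]) (rule assms(3))
  ultimately have "(A, x) \<in> foldSetD D f e \<longleftrightarrow> (A, x) \<in> foldSetD E f e" for x
    by blast
  then show ?thesis by (simp add: foldD_def)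
qed

lemma finsum_eq_foldD:
  assumes "finite A" "\<And>i. i \<in> A \<Longrightarrow> step (F i)"
  shows "finsum Meas_ring F A = foldD (Collect step) (madd \<circ> F) (mconst 0) A"
proof -
  have "finsum Meas_ring F A = foldD Meas (madd \<circ> F) (mconst 0) A"
    using assms(1) by (simp add: finsum_def finprod_def Meas_ring_def)
  also have "\<dots> = foldD (Collect step) (madd \<circ> F) (mconst 0) A"
    using assms(2) by (intro foldD_restrict) (auto simp: step_mconst step_madd step_Meas)
  finally show ?thesis .
qed

lemma finsum_empty_Meas_ring: "finsum Meas_ring F {} = mconst 0"
  using finsum_eq_foldD[of "{}" F] foldD_empty[of "mconst 0" "Collect step"]
  by (simp add: step_mconst)

text \<open>The fold over \<open>Collect step\<close> satisfies the locale \<open>LCD\<close>: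
  closure is \<open>step_madd\<close> and left commutativity is
  \<open>madd_left_commute\<close>.\<close>

lemma finsum_insert_step:
  assumes "finite A" "x \<notin> A" "\<And>i. i \<in> insert x A \<Longrightarrow> step (F i)"
  shows "finsum Meas_ring F (insert x A) = madd (F x) (finsum Meas_ring F A)"
proof -
  interpret LCD "insert x A" "Collect step" "madd \<circ> F"
    using assms(3) by unfold_locales (auto intro: madd_left_commute step_madd)
  have "foldD (Collect step) (madd \<circ> F) (mconst 0) (insert x A) =
      (madd \<circ> F) x (foldD (Collect step) (madd \<circ> F) (mconst 0) A)"
    using assms(1,2) by (intro foldD_insert) (auto simp: step_mconst)
  moreover have "finsum Meas_ring F A = foldD (Collect step) (madd \<circ> F) (mconst 0) A"
    by (rule finsum_eq_foldD) (use assms in auto)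
  moreover have "finsum Meas_ring F (insert x A) =
      foldD (Collect step) (madd \<circ> F) (mconst 0) (insert x A)"
    by (rule finsum_eq_foldD) (use assms in auto)
  ultimately show ?thesis by simp
qed

lemma step_finsum:
  assumes "finite A" "\<And>i. i \<in> A \<Longrightarrow> step (F i)"
  shows "step (finsum Meas_ring F A)"
  using assms
proof (induction A)
  case empty
  show ?case by (simp add: finsum_empty_Meas_ring step_mconst)
next
  case (insert x A)
  then have "step (madd (F x) (finsum Meas_ring F A))" by (intro step_madd) auto
  then show ?case by (subst finsum_insert_step[OF insert.hyps insert.prems])
qed

lemma equals_on_finsum:
  assumes "finite A" "\<And>i. i \<in> A \<Longrightarrow> step (F i)" "\<And>i. i \<in> A \<Longrightarrow> equals_on a (r i) (F i)"
  shows "equals_on a (\<Sum>i\<in>A. r i) (finsum Meas_ring F A)"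
  using assms
proof (induction A)
  case empty
  show ?case by (simp add: finsum_empty_Meas_ring equals_on_mconst)
next
  case (insert x A)
  then have "equals_on a (r x + (\<Sum>i\<in>A. r i)) (madd (F x) (finsum Meas_ring F A))"
    by (intro equals_on_madd step_Meas step_finsum) auto
  then show ?case
    using insert.hyps by (subst finsum_insert_step[OF insert.hyps insert.prems(1)]) auto
qed


section \<open>Simple functions are the locally constant ones\<close>

text \<open>Distributivity gives \<open>c = inf c (sup a d) = inf c d\<close>, and symmetrically for
  \<open>d\<close>. This justifies the definite description in \<open>cmpl\<close>.\<close>

lemma is_compl_unique:
  fixes a :: "'a::sigma_frame"
  assumes "is_compl a c" "is_compl a d"
  shows "c = d"
proof -
  have *: "c = inf c d" if "is_compl a c" "is_compl a d" for c d
    using inf_sup_distrib_sigma_frame[of c a d] that by (simp add: is_compl_def inf.commute)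
  show ?thesis using *[OF assms] *[OF assms(2,1)] by (simp add: inf.commute)
qed

lemma is_compl_cmpl: "complemented a \<Longrightarrow> is_compl a (cmpl a)"
  unfolding complemented_def cmpl_def by (blast intro: theI' is_compl_unique)

text \<open>The cover is \<open>{a, cmpl a}\<close>, with constants 1 and 0. An element disjoint
  from \<open>a\<close> lies below \<open>cmpl a\<close>, so the constant there is 0.\<close>

lemma
  fixes a :: "'a::sigma_frame"
  assumes "complemented a"
  shows step_chi: "step (chi a)"
    and equals_on_chi: "equals_on a 1 (chi a)"
    and equals_on_chi_disjoint: "inf b a = bot \<Longrightarrow> equals_on b 0 (chi a)"
proof -
  let ?u = "\<lambda>p. if p < 0 then top else if p < 1 then a else bot"
  let ?v = "\<lambda>q. if q \<le> 0 then bot else if q \<le> 1 then cmpl a else top"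
  have c: "inf a (cmpl a) = bot" "sup a (cmpl a) = top"
    using is_compl_cmpl[OF assms] by (simp_all add: is_compl_def)
  have 1: "const_on a 1 ?u ?v"
    using c by (simp add: const_on_def)
  have 0: "const_on b 0 ?u ?v" if "inf b a = bot" for b
  proof -
    have "inf b (cmpl a) = b"
      using inf_sup_distrib_sigma_frame[of b a "cmpl a"] c that by simp
    then show ?thesis using that by (simp add: const_on_def)
  qed
  have C: "Sup {a, cmpl a} = top" "finite {a, cmpl a}"
    using c by (simp_all add: csup_insert2)
  have D: "\<exists>r. const_on b r ?u ?v" if "b \<in> {a, cmpl a}" for b
  proof (cases "b = a")
    case True
    then show ?thesis using 1 by blast
  next
    case False
    then have "inf b a = bot" using that c by (auto simp: inf.commute)
    then show ?thesis using 0 by blast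
  qed
  note R = step_ext(1)[OF C(2,1) D]
  show "step (chi a)"
    unfolding chi_def by (rule step_ext(2)[OF C(2,1) D])
  show "equals_on a 1 (chi a)"
    using 1 by (simp only: chi_def equals_on_def ext_gen(2,3)[OF R])
  show "equals_on b 0 (chi a)" if "inf b a = bot"
    using 0[OF that] by (simp only: chi_def equals_on_def ext_gen(2,3)[OF R])
qed

lemma simple_imp_step:
  assumes "simple f"
  shows "step f"
  using assms unfolding simple_def by (auto intro!: step_finsum step_mscale step_chi)

text \<open>Distributivity again; it allows pieces carrying the same constant to be merged.\<close>

lemma equals_on_Sup:
  fixes B :: "'a::sigma_frame set"
  assumes "countable B" "\<And>a. a \<in> B \<Longrightarrow> equals_on a r f"
  shows "equals_on (Sup B) r f"
proof -
  have *: "inf (Sup B) x = (if P then Sup B else bot)"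
    if x: "\<And>a. a \<in> B \<Longrightarrow> inf a x = (if P then a else bot)" for x P
  proof -
    have "inf (Sup B) x = (SUP a\<in>B. if P then a else bot)"
      using x assms(1) by (simp add: csup_inf cong: image_cong_simp)
    also have "\<dots> = (if P then Sup B else bot)"
      using assms(1) by (cases P) (auto intro!: antisym csup_least)
    finally show ?thesis .
  qed
  show ?thesis
    unfolding equals_on_iff
    by (intro conjI allI *) (use assms(2) in \<open>simp_all add: equals_on_iff\<close>)
qed

text \<open>Merging the pieces of a cover by value yields pairwise disjoint \<open>e r\<close> that
  join to \<open>top\<close>; each is complemented by the join of the others, and \<open>f\<close>
  is the sum of the \<open>r\<close>-multiples of their characteristic functions.\<close>

lemma step_imp_simple:
  fixes f :: "lreals \<Rightarrow> 'a::sigma_frame"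
  assumes f: "step f"
  shows "simple f"
proof -
  obtain C where C: "finite C" "Sup C = top" "\<And>a. a \<in> C \<Longrightarrow> \<exists>r. equals_on a r f"
    using f unfolding step_def by blast
  then obtain val where val: "\<And>a. a \<in> C \<Longrightarrow> equals_on a (val a) f" by metis
  define R where "R = val ` C"
  \<comment> \<open>For \<open>r\<close> outside \<open>R\<close> this is the empty join
    \<open>bot\<close>, so the facts about \<open>e\<close> below hold for every rational
    \<open>r\<close>.\<close>
  define e where "e r = Sup {a \<in> C. val a = r}" for r
  have finR: "finite R" using C(1) by (simp add: R_def)
  then have cnt: "countable (e ` S)" if "S \<subseteq> R" for S
    using that by (intro countable_finite finite_imageI) (rule finite_subset)
  have e: "equals_on (e r) r f" for r
    unfolding e_def using C(1) val by (intro equals_on_Sup) (auto intro: countable_finite)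
  have disj: "inf (e r) (e s) = bot" if "r \<noteq> s" for r s
  proof (cases "r < s")
    case True
    then show ?thesis by (rule equals_on_disjoint[OF e e])
  next
    case False
    then have "s < r" using that by simp
    then show ?thesis by (subst inf.commute) (rule equals_on_disjoint[OF e e])
  qed
  have upper: "e r \<le> Sup (e ` R)" if "r \<in> R" for r
    using that cnt[of R] by (intro csup_upper) auto
  have "Sup C \<le> Sup (e ` R)"
  proof (rule csup_least[OF countable_finite[OF C(1)]])
    fix a assume a: "a \<in> C"
    have "a \<le> e (val a)"
      unfolding e_def using C(1) a by (intro csup_upper) (auto intro: countable_finite)
    also have "\<dots> \<le> Sup (e ` R)" using a by (intro upper) (simp add: R_def)
    finally show "a \<le> Sup (e ` R)" .
  qed
  then have top: "Sup (e ` R) = top" by (simp add: C(2) top_unique)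
  have compl: "complemented (e r)" for r
    unfolding complemented_def is_compl_def
  proof (intro exI[of _ "Sup (e ` (R - {r}))"] conjI)
    have "inf (e r) (Sup (e ` (R - {r}))) = (SUP s\<in>R - {r}. inf (e r) (e s))"
      using finR by (intro inf_csup countable_finite) auto
    also have "\<dots> = bot"
      using finR by (intro antisym csup_least) (auto simp: disj intro: countable_finite)
    finally show "inf (e r) (Sup (e ` (R - {r}))) = bot" .
    have "Sup (e ` R) \<le> sup (e r) (Sup (e ` (R - {r})))"
    proof (rule csup_least[OF cnt])
      fix x assume "x \<in> e ` R"
      then obtain s where s: "s \<in> R" "x = e s" by blast
      show "x \<le> sup (e r) (Sup (e ` (R - {r})))"
      proof (cases "s = r")
        case False
        then have "x \<le> Sup (e ` (R - {r}))"
          using s by (intro csup_upper cnt) auto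
        then show ?thesis by (rule le_supI2)
      qed (simp add: s)
    qed simp
    then show "sup (e r) (Sup (e ` (R - {r}))) = top" by (simp add: top top_unique)
  qed
  obtain h where h: "bij_betw h {1..card R} R"
    using ex_bij_betw_nat_finite_1[OF finR] by blast
  let ?g = "\<lambda>i. mscale (h i) (chi (e (h i)))"
  have step: "step (?g i)" for i
    by (intro step_mscale step_chi compl)
  have "f = finsum Meas_ring ?g {1..card R}"
  proof (rule eq_if_equals_on)
    show "f \<in> Meas" using f by (rule step_Meas)
    show "finsum Meas_ring ?g {1..card R} \<in> Meas"
      by (intro step_Meas step_finsum step) simp
    show "finite (e ` R)" "Sup (e ` R) = top" using finR top by auto
  next
    fix b assume "b \<in> e ` R"
    then obtain r where r: "r \<in> R" "b = e r" by blast
    \<comment> \<open>Below \<open>e r\<close> only the summand with index \<open>h i = r\<close>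
      contributes, so the sum has the constant \<open>r\<close> there, as \<open>f\<close>
      does.\<close>
    have "equals_on b (if h i = r then r else 0) (?g i)" for i
    proof (cases "h i = r")
      case True
      then show ?thesis
        using equals_on_mscale[OF step_chi[OF compl] equals_on_chi[OF compl], of r r] r by simp
    next
      case False
      then have "inf b (e (h i)) = bot" using disj r by auto
      from equals_on_mscale[OF step_chi[OF compl] equals_on_chi_disjoint[OF compl this], of "h i"]
      show ?thesis using False by simp
    qed
    then have "equals_on b (\<Sum>i\<in>{1..card R}. if h i = r then r else 0)
        (finsum Meas_ring ?g {1..card R})"
      by (intro equals_on_finsum step) auto
    also have "(\<Sum>i\<in>{1..card R}. if h i = r then r else 0) = (\<Sum>s\<in>R. if s = r then r else 0)"
      by (rule sum.reindex_bij_betw[OF h])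
    also have "\<dots> = r" using r finR by simp
    finally show "\<exists>r. equals_on b r f \<and> equals_on b r (finsum Meas_ring ?g {1..card R})"
      using e r by blast
  qed
  then show ?thesis
    unfolding simple_def using compl
    by (intro exI[of _ "card R"] exI[of _ h] exI[of _ "\<lambda>i. e (h i)"]) simp
qed

section \<open>Closure and the subring property\<close>

lemma SM_eq: "SM = Collect step"
  by (auto simp: SM_def simple_imp_step step_imp_simple step_Meas)

text \<open>The inverse is a definite description over the whole carrier \<open>Meas\<close>:
  \<open>madd_mneg\<close> gives existence, and \<open>mneg_unique\<close> excludes every other
  candidate, locally constant or not.\<close>

lemma inv_add_monoid_Meas_ring:
  assumes "step f"
  shows "inv\<^bsub>add_monoid Meas_ring\<^esub> f = mneg f"
  unfolding m_inv_def
  by (rule the_equality)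
    (use assms in \<open>auto simp: Meas_ring_def madd_mneg step_Meas step_mneg intro: mneg_unique\<close>)

theorem proposition5p7:
  shows "(\<forall>f \<in> (SM :: (lreals \<Rightarrow> 'a::sigma_frame) set). \<forall>g \<in> SM. \<forall>c::rat.
            mscale c f \<in> SM \<and> mneg f \<in> SM \<and> mmult f g \<in> SM \<and> madd f g \<in> SM \<and> modulus f \<in> SM)
       \<and> subring (SM :: (lreals \<Rightarrow> 'a) set) Meas_ring"
proof (intro conjI)
  show "\<forall>f \<in> (SM :: (lreals \<Rightarrow> 'a) set). \<forall>g \<in> SM. \<forall>c::rat.
      mscale c f \<in> SM \<and> mneg f \<in> SM \<and> mmult f g \<in> SM \<and> madd f g \<in> SM \<and> modulus f \<in> SM"
    by (simp add: SM_eq step_mscale step_mneg step_mmult step_madd step_modulus)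
  show "subring (SM :: (lreals \<Rightarrow> 'a) set) Meas_ring"
  \<comment> \<open>A subring is a subgroup for addition and a submonoid for multiplication. Among
    the resulting closure conditions only additive inverses need an argument beyond
    unfolding.\<close>
  proof (intro subring.intro subgroup.intro submonoid.intro)
    fix f :: "lreals \<Rightarrow> 'a"
    assume "f \<in> SM"
    then show "inv\<^bsub>add_monoid Meas_ring\<^esub> f \<in> SM"
      unfolding SM_eq using inv_add_monoid_Meas_ring[of f] step_mneg[of f] by (metis mem_Collect_eq)
  qed (auto simp: SM_eq Meas_ring_def step_Meas step_madd step_mmult step_mconst)
qed

end
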